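(* Assume $\overline V\in\{0,1\}$ and $\mathbf E^-\prec\mathbf E^+$. Let $\mathcal F_{\mathrm{ZO}}$ be the set of all $(\{c_j\}_{j=1}^{n_{lc}},\{\mathbf E_i\}_{i=1}^{n_e})$, $c_j\in\mathbb R$, $\mathbf E_i\in\mathbb S^{2\times2\times2\times2}$, such that $$\begin{pmatrix}c_j&-f_j^T\\-f_j&K_j(\{\mathbf E_i\})\end{pmatrix}\succeq0\ (j=1,\dots,n_{lc}),\quad\mathbf E^-\preceq\mathbf E_i\preceq\mathbf E^+\ (i=1,\dots,n_e),\quad\frac1{n_e}\sum_{i=1}^{n_e}\mathrm{Tr}(\mathbf E_i)\le\overline V\,\mathrm{Tr}(\mathbf E^+)+(1-\overline V)\mathrm{Tr}(\mathbf E^-).$$ Let $\mathcal F_{\mathrm{FO}}$ be the set of all $(\{c_j\},\{\mathbf E_i\})$ for which there exist $v_i^+\in[0,1]$, $i=1,\dots,n_e$, with $$\begin{pmatrix}c_j&-f_j^T\\-f_j&K_j(\{\mathbf E_i\})\end{pmatrix}\succeq0\ (j=1,\dots,n_{lc}),\quad\mathbf E^-\preceq\mathbf E_i\preceq(1-v_i^+)\mathbf E^-+v_i^+\mathbf E^+\ (i=1,\dots,n_e),\quad\frac1{n_e}\sum_{i=1}^{n_e}v_i^+\le\overline V.$$ Then $\mathcal F_{\mathrm{FO}}=\mathcal F_{\mathrm{ZO}}$.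
   Context: $\mathbb S^{2\times2}$ is the space of real symmetric $2\times2$ matrices with the Frobenius inner product; $\mathbb S^{2\times2\times2\times2}$ is the space of fourth-order tensors acting as self-adjoint linear maps on $\mathbb S^{2\times2}$; $\preceq,\prec$ is the Loewner order. $\mathrm{Tr}(\mathbf E)$ is the trace of $\mathbf E$ as a linear map on $\mathbb S^{2\times2}$. $\mathbf E^\pm$ are isotropic, $\mathbf E^\pm\varepsilon=\kappa^\pm\mathrm{Tr}(\varepsilon)I+2\mu^\pm(\varepsilon-\tfrac12\mathrm{Tr}(\varepsilon)I)$, with $0<\kappa^-<\kappa^+$, $0<\mu^-<\mu^+$. Finite-element setting: $n_e\ge1$ equisized elements, $n_{lc}\ge1$ loadcases, load vectors $f_j\in\mathbb R^{n_j}$, and assembled stiffness matrices $K_j(\{\mathbf E_i\})\in\mathbb R^{n_j\times n_j}$, symmetric, linear in $(\mathbf E_1,\dots,\mathbf E_{n_e})$, positive semidefinite if all $\mathbf E_i\succeq0$, and positive definite if all $\mathbf E_i\succ0$. *)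

theory Defs
  imports "HOL-Analysis.Analysis" "Jordan_Normal_Form.Matrix"
begin

(* Jordan_Normal_Form.Matrix and HOL-Analysis both use these symbols. Below, the
   infix dot is the inner product of real_inner, the dollar is the component of a
   Cartesian vector; the scalar product of variable-dimension vectors is written
   out as scalar_prod. *)
no_notation Matrix.scalar_prod (infix "\<bullet>" 70)
no_notation Matrix.vec_index (infixl "$" 100)

section \<open>Symmetric two-by-two matrices\<close>

typedef sym2 = "{A :: real^2^2. transpose A = A}"
  morphisms mat_of_sym2 sym2_of_mat
  by (rule exI[of _ 0]) (simp add: transpose_def Finite_Cartesian_Product.vec_eq_iff)

setup_lifting type_definition_sym2

text \<open>The inner product inherited from \<^typ>\<open>real^2^2\<close> is the Frobenius inner product.\<close>

instantiation sym2 :: real_inner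
begin

lift_definition zero_sym2 :: sym2 is 0
  by (simp add: transpose_def Finite_Cartesian_Product.vec_eq_iff)
lift_definition plus_sym2 :: "sym2 \<Rightarrow> sym2 \<Rightarrow> sym2" is "(+)"
  by (simp add: transpose_def Finite_Cartesian_Product.vec_eq_iff)
lift_definition minus_sym2 :: "sym2 \<Rightarrow> sym2 \<Rightarrow> sym2" is "(-)"
  by (simp add: transpose_def Finite_Cartesian_Product.vec_eq_iff)
lift_definition uminus_sym2 :: "sym2 \<Rightarrow> sym2" is uminus
  by (simp add: transpose_def Finite_Cartesian_Product.vec_eq_iff)
lift_definition scaleR_sym2 :: "real \<Rightarrow> sym2 \<Rightarrow> sym2" is scaleR
  by (simp add: transpose_def Finite_Cartesian_Product.vec_eq_iff)
lift_definition inner_sym2 :: "sym2 \<Rightarrow> sym2 \<Rightarrow> real" is inner .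

definition norm_sym2 :: "sym2 \<Rightarrow> real" where "norm_sym2 x = sqrt (x \<bullet> x)"
definition dist_sym2 :: "sym2 \<Rightarrow> sym2 \<Rightarrow> real" where "dist_sym2 x y = norm (x - y)"
definition sgn_sym2 :: "sym2 \<Rightarrow> sym2" where "sgn_sym2 x = inverse (norm x) *\<^sub>R x"
definition uniformity_sym2 :: "(sym2 \<times> sym2) filter"
  where "uniformity_sym2 = (INF e\<in>{0<..}. principal {(x, y). dist x y < e})"
definition open_sym2 :: "sym2 set \<Rightarrow> bool"
  where "open_sym2 U \<longleftrightarrow> (\<forall>x\<in>U. \<forall>\<^sub>F (x', y) in uniformity. x' = x \<longrightarrow> y \<in> U)"

instance
proof
  fix x y z :: sym2 and a b :: real and U :: "sym2 set"
  show "x + y + z = x + (y + z)" by transfer simp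
  show "x + y = y + x" by transfer simp
  show "0 + x = x" by transfer simp
  show "- x + x = 0" by transfer simp
  show "x - y = x + - y" by transfer simp
  show "a *\<^sub>R (x + y) = a *\<^sub>R x + a *\<^sub>R y" by transfer (simp add: algebra_simps)
  show "(a + b) *\<^sub>R x = a *\<^sub>R x + b *\<^sub>R x" by transfer (simp add: algebra_simps)
  show "a *\<^sub>R b *\<^sub>R x = (a * b) *\<^sub>R x" by transfer simp
  show "1 *\<^sub>R x = x" by transfer simp
  show "dist x y = norm (x - y)" by (rule dist_sym2_def)
  show "sgn x = inverse (norm x) *\<^sub>R x" by (rule sgn_sym2_def)
  show "uniformity = (INF e\<in>{0<..}. principal {(x :: sym2, y). dist x y < e})"
    by (rule uniformity_sym2_def)
  show "open U \<longleftrightarrow> (\<forall>x\<in>U. \<forall>\<^sub>F (x', y) in uniformity. x' = x \<longrightarrow> y \<in> U)"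
    by (rule open_sym2_def)
  show "x \<bullet> y = y \<bullet> x" by transfer (rule inner_commute)
  show "(x + y) \<bullet> z = x \<bullet> z + y \<bullet> z" by transfer (rule inner_add_left)
  show "(a *\<^sub>R x) \<bullet> y = a * (x \<bullet> y)" by transfer (rule inner_scaleR_left)
  show "0 \<le> x \<bullet> x" by transfer (rule inner_ge_zero)
  show "x \<bullet> x = 0 \<longleftrightarrow> x = 0" by transfer (rule inner_eq_zero_iff)
  show "norm x = sqrt (x \<bullet> x)" by (rule norm_sym2_def)
qed

end

lift_definition mk_sym2 :: "real \<Rightarrow> real \<Rightarrow> real \<Rightarrow> sym2"
  is "\<lambda>a b d. vector [vector [a, b], vector [b, d]]"
  by (simp add: transpose_def Finite_Cartesian_Product.vec_eq_iff forall_2)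

lemma inner_mk_sym2: "mk_sym2 a b d \<bullet> mk_sym2 a' b' d' = a * a' + 2 * (b * b') + d * d'"
  by transfer (simp add: inner_vec_def sum_2)

lemma mk_sym2_cases: obtains a b d where "x = mk_sym2 a b d"
proof -
  define A where "A = mat_of_sym2 x"
  have "transpose A = A" using mat_of_sym2[of x] by (simp add: A_def)
  then have "A $ 1 $ 2 = A $ 2 $ 1"
    by (simp add: transpose_def Finite_Cartesian_Product.vec_eq_iff)
  then have "A = vector [vector [A $ 1 $ 1, A $ 1 $ 2], vector [A $ 1 $ 2, A $ 2 $ 2]]"
    by (simp add: Finite_Cartesian_Product.vec_eq_iff forall_2)
  then have "x = mk_sym2 (A $ 1 $ 1) (A $ 1 $ 2) (A $ 2 $ 2)"
    by (simp add: A_def mk_sym2.rep_eq flip: mat_of_sym2_inject)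
  then show thesis by (rule that)
qed

lemma zero_sym2_eq: "0 = mk_sym2 0 0 0"
  by transfer (simp add: Finite_Cartesian_Product.vec_eq_iff forall_2)

lemma mk_sym2_eq_iff: "mk_sym2 a b d = mk_sym2 a' b' d' \<longleftrightarrow> a = a' \<and> b = b' \<and> d = d'"
  by transfer (auto simp add: Finite_Cartesian_Product.vec_eq_iff forall_2)

instantiation sym2 :: euclidean_space
begin

definition Basis_sym2 :: "sym2 set"
  where "Basis_sym2 = {mk_sym2 1 0 0, mk_sym2 0 (1 / sqrt 2) 0, mk_sym2 0 0 1}"

instance
proof
  show "(Basis :: sym2 set) \<noteq> {}" "finite (Basis :: sym2 set)"
    by (simp_all add: Basis_sym2_def)
  have s: "2 * (1 / sqrt 2 * (1 / sqrt 2)) = (1 :: real)" by simp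
  fix u v :: sym2
  show "u \<bullet> v = (if u = v then 1 else 0)" if "u \<in> Basis" "v \<in> Basis"
    using that s by (auto simp: Basis_sym2_def inner_mk_sym2 mk_sym2_eq_iff)
  show "(\<forall>u\<in>Basis. v \<bullet> u = 0) \<longleftrightarrow> v = 0"
    by (cases v rule: mk_sym2_cases)
      (simp add: Basis_sym2_def inner_mk_sym2 zero_sym2_eq mk_sym2_eq_iff conj_commute)
qed

end

definition tr_sym2 :: "sym2 \<Rightarrow> real" where "tr_sym2 \<epsilon> = trace (mat_of_sym2 \<epsilon>)"

lift_definition id_sym2 :: sym2 is "Finite_Cartesian_Product.mat 1 :: real^2^2"
  by (simp add: Finite_Cartesian_Product.transpose_mat)

section \<open>Fourth-order tensors\<close>

typedef tensor4 =
  "{E :: sym2 \<Rightarrow> sym2. linear E \<and> (\<forall>\<epsilon> \<eta>. E \<epsilon> \<bullet> \<eta> = \<epsilon> \<bullet> E \<eta>)}"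
  morphisms app4 tensor4_of_fun
  by (rule exI[of _ id]) (simp add: linear_id[unfolded id_def] id_def)

setup_lifting type_definition_tensor4

instantiation tensor4 :: real_vector
begin

lift_definition zero_tensor4 :: tensor4 is "\<lambda>_. 0"
  by (simp add: module_hom_zero)
lift_definition plus_tensor4 :: "tensor4 \<Rightarrow> tensor4 \<Rightarrow> tensor4" is "\<lambda>E F \<epsilon>. E \<epsilon> + F \<epsilon>"
  by (simp add: linear_compose_add inner_add_left inner_add_right)
lift_definition minus_tensor4 :: "tensor4 \<Rightarrow> tensor4 \<Rightarrow> tensor4" is "\<lambda>E F \<epsilon>. E \<epsilon> - F \<epsilon>"
  by (simp add: linear_compose_sub inner_diff_left inner_diff_right)
lift_definition uminus_tensor4 :: "tensor4 \<Rightarrow> tensor4" is "\<lambda>E \<epsilon>. - E \<epsilon>"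
  by (simp add: linear_compose_neg)
lift_definition scaleR_tensor4 :: "real \<Rightarrow> tensor4 \<Rightarrow> tensor4" is "\<lambda>a E \<epsilon>. a *\<^sub>R E \<epsilon>"
  by (simp add: linear_compose_scale_right)

instance
  by standard (transfer, simp add: fun_eq_iff algebra_simps)+

end

definition loewner_le :: "tensor4 \<Rightarrow> tensor4 \<Rightarrow> bool" (infix "\<preceq>\<^sub>L" 50)
  where "E \<preceq>\<^sub>L F \<longleftrightarrow> (\<forall>\<epsilon>. 0 \<le> \<epsilon> \<bullet> app4 (F - E) \<epsilon>)"

definition loewner_less :: "tensor4 \<Rightarrow> tensor4 \<Rightarrow> bool" (infix "\<prec>\<^sub>L" 50)
  where "E \<prec>\<^sub>L F \<longleftrightarrow> (\<forall>\<epsilon>. \<epsilon> \<noteq> 0 \<longrightarrow> 0 < \<epsilon> \<bullet> app4 (F - E) \<epsilon>)"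

text \<open>Trace as a linear map, computed in an orthonormal basis.\<close>

definition tr4 :: "tensor4 \<Rightarrow> real"
  where "tr4 E = (\<Sum>b\<in>Basis. app4 E b \<bullet> b)"

lemma id_sym2_eq: "id_sym2 = mk_sym2 1 0 1"
  by transfer (simp add: Finite_Cartesian_Product.vec_eq_iff forall_2 Finite_Cartesian_Product.mat_def)

lemma tr_mk_sym2: "tr_sym2 (mk_sym2 a b d) = a + d"
  by (simp add: tr_sym2_def trace_def sum_2 mk_sym2.rep_eq)

lemma tr_sym2_linear: "linear tr_sym2"
  by (rule linearI)
    (simp_all add: tr_sym2_def trace_def sum_2 plus_sym2.rep_eq scaleR_sym2.rep_eq algebra_simps)

lemma tr_sym2_inner: "tr_sym2 \<epsilon> = \<epsilon> \<bullet> id_sym2"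
  by (cases \<epsilon> rule: mk_sym2_cases) (simp add: tr_mk_sym2 id_sym2_eq inner_mk_sym2)

text \<open>\<open>\<kappa>\<close> and \<open>\<mu>\<close> are the plane bulk and shear moduli.\<close>

lift_definition iso4 :: "real \<Rightarrow> real \<Rightarrow> tensor4"
  is "\<lambda>\<kappa> \<mu> \<epsilon>. (\<kappa> * tr_sym2 \<epsilon>) *\<^sub>R id_sym2 + (2 * \<mu>) *\<^sub>R (\<epsilon> - (tr_sym2 \<epsilon> / 2) *\<^sub>R id_sym2)"
proof -
  fix \<kappa> \<mu> :: real
  let ?E = "\<lambda>\<epsilon>. (\<kappa> * tr_sym2 \<epsilon>) *\<^sub>R id_sym2 + (2 * \<mu>) *\<^sub>R (\<epsilon> - (tr_sym2 \<epsilon> / 2) *\<^sub>R id_sym2)"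
  have "linear ?E"
    by (rule linearI)
      (simp_all add: linear_add[OF tr_sym2_linear] linear_scale[OF tr_sym2_linear]
        algebra_simps add_divide_distrib)
  moreover have "?E \<epsilon> \<bullet> \<eta> = \<epsilon> \<bullet> ?E \<eta>" for \<epsilon> \<eta>
    by (simp add: tr_sym2_inner inner_add_left inner_add_right inner_diff_left inner_diff_right
        inner_commute algebra_simps)
  ultimately show "linear ?E \<and> (\<forall>\<epsilon> \<eta>. ?E \<epsilon> \<bullet> \<eta> = \<epsilon> \<bullet> ?E \<eta>)" by blast
qed

lemma tr4_iso4: "tr4 (iso4 \<kappa> \<mu>) = 2 * \<kappa> + 4 * \<mu>"
proof -
  have "finite {mk_sym2 1 0 0, mk_sym2 0 (1 / sqrt 2) 0, mk_sym2 0 0 1}" by simp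
  then show ?thesis
    by (simp add: tr4_def Basis_sym2_def mk_sym2_eq_iff iso4.rep_eq inner_add_left inner_diff_left
        tr_mk_sym2 id_sym2_eq inner_mk_sym2)
qed

section \<open>Matrices of variable dimension\<close>

definition symmetric_mat :: "real Matrix.mat \<Rightarrow> bool"
  where "symmetric_mat A \<longleftrightarrow> square_mat A \<and> transpose_mat A = A"

definition pos_semidef :: "real Matrix.mat \<Rightarrow> bool"
  where "pos_semidef A \<longleftrightarrow> symmetric_mat A \<and>
    (\<forall>v \<in> carrier_vec (dim_row A). 0 \<le> scalar_prod v (A *\<^sub>v v))"

definition pos_def :: "real Matrix.mat \<Rightarrow> bool"
  where "pos_def A \<longleftrightarrow> symmetric_mat A \<and>
    (\<forall>v \<in> carrier_vec (dim_row A). v \<noteq> 0\<^sub>v (dim_row A) \<longrightarrow> 0 < scalar_prod v (A *\<^sub>v v))"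

definition compliance_mat :: "real \<Rightarrow> real Matrix.vec \<Rightarrow> real Matrix.mat \<Rightarrow> real Matrix.mat"
  where "compliance_mat c f K =
    four_block_mat (Matrix.mat 1 1 (\<lambda>_. c)) (- mat_of_row f) (- transpose_mat (mat_of_row f)) K"

section \<open>Feasible sets\<close>

text \<open>The finite type \<open>'e\<close> indexes the elements (so \<open>n\<^sub>e\<close> is \<open>CARD('e)\<close>) and the
  finite type \<open>'l\<close> the load cases; the dimension \<open>n j\<close> may differ between load cases.\<close>

definition stiffness_assembly ::
    "('l::finite \<Rightarrow> nat) \<Rightarrow> ('l \<Rightarrow> ('e::finite \<Rightarrow> tensor4) \<Rightarrow> real Matrix.mat) \<Rightarrow> bool"
  where "stiffness_assembly n K \<longleftrightarrow> (\<forall>j.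
    (\<forall>E. K j E \<in> carrier_mat (n j) (n j) \<and> symmetric_mat (K j E)) \<and>
    (\<forall>E F. K j (\<lambda>i. E i + F i) = K j E + K j F) \<and>
    (\<forall>a E. K j (\<lambda>i. a *\<^sub>R E i) = a \<cdot>\<^sub>m K j E) \<and>
    (\<forall>E. (\<forall>i. 0 \<preceq>\<^sub>L E i) \<longrightarrow> pos_semidef (K j E)) \<and>
    (\<forall>E. (\<forall>i. 0 \<prec>\<^sub>L E i) \<longrightarrow> pos_def (K j E)))"

definition F_ZO ::
    "real \<Rightarrow> tensor4 \<Rightarrow> tensor4 \<Rightarrow> ('l::finite \<Rightarrow> real Matrix.vec) \<Rightarrow>
     ('l \<Rightarrow> ('e::finite \<Rightarrow> tensor4) \<Rightarrow> real Matrix.mat) \<Rightarrow> (('l \<Rightarrow> real) \<times> ('e \<Rightarrow> tensor4)) set"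
  where "F_ZO V Em Ep f K = {(c, E).
    (\<forall>j. pos_semidef (compliance_mat (c j) (f j) (K j E))) \<and>
    (\<forall>i. Em \<preceq>\<^sub>L E i \<and> E i \<preceq>\<^sub>L Ep) \<and>
    (1 / real CARD('e)) * (\<Sum>i\<in>UNIV. tr4 (E i)) \<le> V * tr4 Ep + (1 - V) * tr4 Em}"

definition F_FO ::
    "real \<Rightarrow> tensor4 \<Rightarrow> tensor4 \<Rightarrow> ('l::finite \<Rightarrow> real Matrix.vec) \<Rightarrow>
     ('l \<Rightarrow> ('e::finite \<Rightarrow> tensor4) \<Rightarrow> real Matrix.mat) \<Rightarrow> (('l \<Rightarrow> real) \<times> ('e \<Rightarrow> tensor4)) set"
  where "F_FO V Em Ep f K = {(c, E). \<exists>v :: 'e \<Rightarrow> real.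
    (\<forall>i. v i \<in> {0..1}) \<and>
    (\<forall>j. pos_semidef (compliance_mat (c j) (f j) (K j E))) \<and>
    (\<forall>i. Em \<preceq>\<^sub>L E i \<and> E i \<preceq>\<^sub>L (1 - v i) *\<^sub>R Em + v i *\<^sub>R Ep) \<and>
    (1 / real CARD('e)) * (\<Sum>i\<in>UNIV. v i) \<le> V}"

end

(* The loosened bound of F_FO always implies both constraints of F_ZO, because the trace is
   linear and Loewner-monotone. Conversely, v = 1 is admissible when V = 1; when V = 0 the trace
   constraint forces tr (E i) = tr Em, and a positive semidefinite tensor of trace zero vanishes,
   so E i = Em and v = 0 is admissible. *)
theory Submission
  imports Defs
begin

lemma tr4_add: "tr4 (E + F) = tr4 E + tr4 F"
  by (simp add: tr4_def plus_tensor4.rep_eq inner_add_left sum.distrib)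

lemma tr4_diff: "tr4 (E - F) = tr4 E - tr4 F"
  by (simp add: tr4_def minus_tensor4.rep_eq inner_diff_left sum_subtractf)

lemma tr4_scaleR: "tr4 (a *\<^sub>R E) = a * tr4 E"
  by (simp add: tr4_def scaleR_tensor4.rep_eq sum_distrib_left)

lemma loewner_le_trans:
  assumes "E \<preceq>\<^sub>L F" and "F \<preceq>\<^sub>L G"
  shows "E \<preceq>\<^sub>L G"
  unfolding loewner_le_def
proof
  fix \<epsilon>
  have "app4 (G - E) \<epsilon> = app4 (G - F) \<epsilon> + app4 (F - E) \<epsilon>"
    by (simp add: minus_tensor4.rep_eq)
  then show "0 \<le> \<epsilon> \<bullet> app4 (G - E) \<epsilon>"
    using assms by (simp add: loewner_le_def inner_add_right)
qed

text \<open>The strict order leaves open only \<open>\<epsilon> = 0\<close>, where the quadratic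
  form is 0.\<close>

lemma loewner_less_imp_le: "E \<prec>\<^sub>L F \<Longrightarrow> E \<preceq>\<^sub>L F"
  unfolding loewner_le_def loewner_less_def by (metis inner_zero_left order.strict_implies_order order_refl)

lemma loewner_le_refl: "E \<preceq>\<^sub>L E"
  by (simp add: loewner_le_def zero_tensor4.rep_eq)

text \<open>The gap to \<open>F\<close> is \<open>F - E\<close> scaled by \<open>1 - v\<close>. This
  turns the bound that depends on \<open>v\<close> into the fixed bound \<open>Ep\<close>.\<close>

lemma convex_combination_loewner_le:
  assumes "E \<preceq>\<^sub>L F" and "v \<le> 1"
  shows "(1 - v) *\<^sub>R E + v *\<^sub>R F \<preceq>\<^sub>L F"
proof -
  have "F - ((1 - v) *\<^sub>R E + v *\<^sub>R F) = (1 - v) *\<^sub>R (F - E)"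
    by (simp add: algebra_simps)
  then show ?thesis
    using assms by (simp add: loewner_le_def scaleR_tensor4.rep_eq)
qed

text \<open>The trace of \<open>F - E\<close> sums its quadratic form over an orthonormal basis, so
  every summand is nonnegative.\<close>

lemma tr4_mono:
  assumes "E \<preceq>\<^sub>L F"
  shows "tr4 E \<le> tr4 F"
proof -
  have "0 \<le> tr4 (F - E)"
    using assms unfolding tr4_def loewner_le_def
    by (intro sum_nonneg) (simp add: inner_commute)
  then show ?thesis by (simp add: tr4_diff)
qed

text \<open>A positive semidefinite map of trace zero vanishes: its diagonal entries are nonnegative
  with sum zero, and a zero diagonal forces the remaining entries to vanish. No spectral theorem is
  involved.\<close>

lemma loewner_le_tr4_eq_imp_eq:
  assumes le: "E \<preceq>\<^sub>L F" and tr: "tr4 E = tr4 F"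
  shows "E = F"
proof -
  define D where "D = F - E"
  have psd: "0 \<le> \<epsilon> \<bullet> app4 D \<epsilon>" for \<epsilon>
    using le by (simp add: loewner_le_def D_def)
  have lin: "linear (app4 D)" and sym: "app4 D \<epsilon> \<bullet> \<eta> = \<epsilon> \<bullet> app4 D \<eta>" for \<epsilon> \<eta>
    using app4[of D] by auto
  have "(\<Sum>b\<in>Basis. b \<bullet> app4 D b) = 0"
    using tr tr4_diff[of F E] by (simp add: tr4_def D_def inner_commute)
  then have diag: "b \<bullet> app4 D b = 0" if "b \<in> Basis" for b
    using that psd by (subst (asm) sum_nonneg_eq_0_iff) auto
  have offdiag: "app4 D b \<bullet> c = 0" if "b \<in> Basis" "c \<in> Basis" for b c
  proof -
    have eq: "c \<bullet> app4 D b = b \<bullet> app4 D c"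
      using sym[of c b] by (simp add: inner_commute)
    \<comment> \<open>As the diagonal is zero, the form at \<open>b + c\<close> is twice the entry
      at \<open>b\<close>, \<open>c\<close>, and at \<open>b - c\<close> it is the negative of that;
      both are nonnegative.\<close>
    have "0 \<le> 2 * (b \<bullet> app4 D c)"
      using psd[of "b + c"] diag that
      by (simp add: linear_add[OF lin] inner_add_left inner_add_right eq)
    moreover have "0 \<le> - 2 * (b \<bullet> app4 D c)"
      using psd[of "b - c"] diag that
      by (simp add: linear_diff[OF lin] inner_diff_left inner_diff_right eq)
    ultimately show ?thesis by (simp add: sym)
  qed
  have "app4 D b = 0" if "b \<in> Basis" for b
    using offdiag[OF that] by (rule euclidean_eqI[of _ 0, simplified])
  then have "app4 D = (\<lambda>_. 0)"
    by (intro linear_eq_stdbasis[OF lin linear_zero]) auto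
  then have "D = 0"
    by (simp add: zero_tensor4.rep_eq flip: app4_inject)
  then show ?thesis by (simp add: D_def)
qed

text \<open>Taking traces in the upper bounds and averaging over the elements turns the bound on the
  mean of \<open>v\<close> into the trace constraint.\<close>

lemma F_FO_subset_F_ZO:
  fixes K :: "'l::finite \<Rightarrow> ('e::finite \<Rightarrow> tensor4) \<Rightarrow> real Matrix.mat"
  assumes "Em \<preceq>\<^sub>L Ep"
  shows "F_FO V Em Ep f K \<subseteq> F_ZO V Em Ep f K"
proof clarify
  fix c and E :: "'e \<Rightarrow> tensor4"
  assume "(c, E) \<in> F_FO V Em Ep f K"
  then obtain v :: "'e \<Rightarrow> real" where v: "\<And>i. v i \<in> {0..1}"
    and psd: "\<And>j. pos_semidef (compliance_mat (c j) (f j) (K j E))"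
    and lo: "\<And>i. Em \<preceq>\<^sub>L E i"
    and up: "\<And>i. E i \<preceq>\<^sub>L (1 - v i) *\<^sub>R Em + v i *\<^sub>R Ep"
    and avg: "(1 / real CARD('e)) * (\<Sum>i\<in>UNIV. v i) \<le> V"
    unfolding F_FO_def by blast
  have "E i \<preceq>\<^sub>L Ep" for i
    using loewner_le_trans[OF up convex_combination_loewner_le[OF assms]] v[of i] by simp
  moreover have "(1 / real CARD('e)) * (\<Sum>i\<in>UNIV. tr4 (E i)) \<le> V * tr4 Ep + (1 - V) * tr4 Em"
  proof -
    have "tr4 (E i) \<le> tr4 Em + v i * (tr4 Ep - tr4 Em)" for i
      using tr4_mono[OF up[of i], unfolded tr4_add tr4_scaleR] by (simp add: algebra_simps)
    then have "(\<Sum>i\<in>UNIV. tr4 (E i)) \<le> (\<Sum>i\<in>UNIV. tr4 Em + v i * (tr4 Ep - tr4 Em))"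
      by (rule sum_mono)
    also have "\<dots> = CARD('e) * tr4 Em + (\<Sum>i\<in>UNIV. v i) * (tr4 Ep - tr4 Em)"
      by (simp add: sum.distrib sum_distrib_right)
    finally have "(1 / real CARD('e)) * (\<Sum>i\<in>UNIV. tr4 (E i))
        \<le> tr4 Em + (1 / real CARD('e)) * (\<Sum>i\<in>UNIV. v i) * (tr4 Ep - tr4 Em)"
      by (simp add: field_simps)
    \<comment> \<open>The bound on the mean of \<open>v\<close> may be multiplied by
      \<open>tr4 Ep - tr4 Em\<close>, which is nonnegative by monotonicity of the trace.\<close>
    also have "\<dots> \<le> tr4 Em + V * (tr4 Ep - tr4 Em)"
      using avg tr4_mono[OF assms] by (intro add_left_mono mult_right_mono) auto
    finally show ?thesis by (simp add: algebra_simps)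
  qed
  ultimately show "(c, E) \<in> F_ZO V Em Ep f K"
    using psd lo unfolding F_ZO_def by blast
qed

text \<open>No trace lies below \<open>tr4 Em\<close>, so an average of at most
  \<open>tr4 Em\<close> leaves no slack in any element, and equal traces give equal tensors.\<close>

lemma tr4_average_le_imp_eq:
  fixes E :: "'e::finite \<Rightarrow> tensor4"
  assumes lo: "\<And>i. Em \<preceq>\<^sub>L E i"
    and avg: "(1 / real CARD('e)) * (\<Sum>i\<in>UNIV. tr4 (E i)) \<le> tr4 Em"
  shows "E i = Em"
proof -
  have nonneg: "0 \<le> tr4 (E i) - tr4 Em" for i
    using tr4_mono[OF lo] by simp
  have "(\<Sum>i\<in>UNIV. tr4 (E i) - tr4 Em) \<le> 0"
    using avg by (simp add: sum_subtractf field_simps)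
  then have "(\<Sum>i\<in>UNIV. tr4 (E i) - tr4 Em) = 0"
    using sum_nonneg[of UNIV "\<lambda>i. tr4 (E i) - tr4 Em"] nonneg by simp
  then have "tr4 (E i) - tr4 Em = 0"
    using nonneg by (subst (asm) sum_nonneg_eq_0_iff) auto
  then show ?thesis
    using loewner_le_tr4_eq_imp_eq[OF lo[of i]] by simp
qed

lemma F_ZO_subset_F_FO:
  fixes K :: "'l::finite \<Rightarrow> ('e::finite \<Rightarrow> tensor4) \<Rightarrow> real Matrix.mat"
  assumes "V \<in> {0, 1}"
  shows "F_ZO V Em Ep f K \<subseteq> F_FO V Em Ep f K"
proof clarify
  fix c and E :: "'e \<Rightarrow> tensor4"
  assume "(c, E) \<in> F_ZO V Em Ep f K"
  then have psd: "\<And>j. pos_semidef (compliance_mat (c j) (f j) (K j E))"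
    and lo: "\<And>i. Em \<preceq>\<^sub>L E i" and up: "\<And>i. E i \<preceq>\<^sub>L Ep"
    and avg: "(1 / real CARD('e)) * (\<Sum>i\<in>UNIV. tr4 (E i)) \<le> V * tr4 Ep + (1 - V) * tr4 Em"
    unfolding F_ZO_def by blast+
  \<comment> \<open>The right-hand side is \<open>Em\<close> for \<open>V = 0\<close> and
    \<open>Ep\<close> for \<open>V = 1\<close>, so a single formula serves both cases.\<close>
  have "E i \<preceq>\<^sub>L (1 - V) *\<^sub>R Em + V *\<^sub>R Ep" for i
  proof (cases "V = 0")
    case True
    then show ?thesis
      using tr4_average_le_imp_eq[of Em E, OF lo] avg by (simp add: loewner_le_refl)
  next
    case False
    then show ?thesis using assms up by simp
  qed
  then show "(c, E) \<in> F_FO V Em Ep f K"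
    \<comment> \<open>The constant function \<open>V\<close> is the witness: its values lie in the
      unit interval and its mean is exactly \<open>V\<close>.\<close>
    using assms psd lo unfolding F_FO_def by (auto intro!: exI[of _ "\<lambda>_. V"])
qed

theorem mainTheorem5:
  fixes \<kappa>m \<kappa>p \<mu>m \<mu>p V :: real
    and Em Ep :: tensor4
    and n :: "'l::finite \<Rightarrow> nat"
    and f :: "'l \<Rightarrow> real Matrix.vec"
    and K :: "'l \<Rightarrow> ('e::finite \<Rightarrow> tensor4) \<Rightarrow> real Matrix.mat"
  assumes "0 < \<kappa>m" and "\<kappa>m < \<kappa>p" and "0 < \<mu>m" and "\<mu>m < \<mu>p"
    and "Em = iso4 \<kappa>m \<mu>m" and "Ep = iso4 \<kappa>p \<mu>p"
    and "Em \<prec>\<^sub>L Ep"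
    and "\<And>j. f j \<in> carrier_vec (n j)"
    and "stiffness_assembly n K"
    and "V \<in> {0, 1}"
  shows "F_FO V Em Ep f K = F_ZO V Em Ep f K"
  using F_FO_subset_F_ZO[OF loewner_less_imp_le[OF \<open>Em \<prec>\<^sub>L Ep\<close>]]
    F_ZO_subset_F_FO[OF \<open>V \<in> {0, 1}\<close>]
  by (rule equalityI)

end
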